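(* Let $n>4$ be an integer and let $1\leq r<k<n$ be integers. Let $\Gamma=\mathrm{Cay}(G,H)$ with $H=C(n,k;r)$, where $G=S_n$ when $k$ is even and $G=A_n$ when $k$ is odd. Then $$\mu_2=(k-2)!\binom{n-r}{k-r}\frac{1}{n-r}\left((k-1)(n-k)-\frac{(k-r-1)(k-r)}{n-r-1}\right)$$ is an eigenvalue of $\Gamma$, and hence $\lambda_2(\Gamma)\geq\mu_2$.
   Context: $S_n$ and $A_n$ are the symmetric and alternating groups on $\{1,\dots,n\}$. For $1\le r<k\le n$, $C(n,k;r)$ is the set of all $k$-cycles $(i_1,i_2,\dots,i_k)(i_{k+1})\cdots(i_n)$ in $S_n$ that move all the points $1,2,\dots,r$, i.e. with $\{1,\dots,r\}\subset\{i_1,\dots,i_k\}$. For a finite group $G$, a subset $H\subset G$ is a connecting set if $1\notin H$, $H=H^{-1}$, and $H$ is not contained in any proper subgroup of $G$. For a connecting set $H$, the Cayley graph $\mathrm{Cay}(G,H)$ has vertex set $G$, with $u,v\in G$ adjacent if and only if $uv^{-1}\in H$. The eigenvalues of a graph are those of its adjacency matrix. The distinct eigenvalues of a graph $\Gamma$ are written $\lambda_1(\Gamma)>\lambda_2(\Gamma)>\cdots$, so $\lambda_1$ is the largest and $\lambda_2$ the second largest eigenvalue. *)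

theory Defs
  imports
    "HOL-Algebra.Sym_Groups"
    "Jordan_Normal_Form.Char_Poly"
    "Graph_Theory.Pair_Digraph"
begin

text \<open>The set $C(n,k;r)$. Fixed points are left implicit: a permutation of $\{1,\dots,n\}$ is a
  function on \<^typ>\<open>nat\<close> that is the identity outside $\{1,\dots,n\}$, as in \<^const>\<open>sym_group\<close>.
  For $k \ge 2$, the set of points moved by \<^term>\<open>cycle_of_list cs\<close> is \<^term>\<open>set cs\<close>.\<close>

definition cycles_moving :: "nat \<Rightarrow> nat \<Rightarrow> nat \<Rightarrow> (nat \<Rightarrow> nat) set" where
  "cycles_moving n k r =
    {cycle_of_list cs | cs. cycle cs \<and> length cs = k \<and> set cs \<subseteq> {1..n} \<and> {1..r} \<subseteq> set cs}"

text \<open>An undirected edge is represented by its two arcs. The definition makes sense for every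
  \<^term>\<open>H\<close>; when \<^term>\<open>H\<close> is closed under inverses and does not contain the unit, the result is a
  loopless symmetric digraph, i.e. a simple graph.\<close>

definition cayley_graph :: "('a, 'b) monoid_scheme \<Rightarrow> 'a set \<Rightarrow> 'a pair_pre_digraph" where
  "cayley_graph G H =
    \<lparr>pverts = carrier G,
     parcs = {(u, v). u \<in> carrier G \<and> v \<in> carrier G \<and> u \<otimes>\<^bsub>G\<^esub> inv\<^bsub>G\<^esub> v \<in> H}\<rparr>"

text \<open>The adjacency matrix with respect to an enumeration \<^term>\<open>vs\<close> of the vertices.\<close>

definition adjacency_mat :: "'a list \<Rightarrow> 'a pair_pre_digraph \<Rightarrow> real mat" where
  "adjacency_mat vs \<Gamma> =
    mat (length vs) (length vs) (\<lambda>(i, j). if (vs ! i, vs ! j) \<in> parcs \<Gamma> then 1 else 0)"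

text \<open>The enumeration is immaterial, see \<open>graph_eigenvalues_eq\<close> below. Real eigenvalues suffice
  because the adjacency matrix of an undirected graph is real symmetric.\<close>

definition graph_eigenvalues :: "'a pair_pre_digraph \<Rightarrow> real set" where
  "graph_eigenvalues \<Gamma> =
    {x. \<exists>vs. distinct vs \<and> set vs = pverts \<Gamma> \<and> eigenvalue (adjacency_mat vs \<Gamma>) x}"

text \<open>The \<^term>\<open>i\<close>-th largest distinct eigenvalue, counting from $i = 1$; unspecified if there are
  fewer than \<^term>\<open>i\<close> distinct eigenvalues.\<close>

definition nth_largest_eigenvalue :: "'a pair_pre_digraph \<Rightarrow> nat \<Rightarrow> real" where
  "nth_largest_eigenvalue \<Gamma> i = rev (sorted_list_of_set (graph_eigenvalues \<Gamma>)) ! (i - 1)"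

lemma eigenvalue_adjacency_mat_iff:
  assumes vs: "distinct vs"
  shows "eigenvalue (adjacency_mat vs \<Gamma>) x \<longleftrightarrow>
    (\<exists>f. (\<exists>u\<in>set vs. f u \<noteq> 0) \<and>
         (\<forall>u\<in>set vs. (\<Sum>v\<in>set vs. (if (u, v) \<in> parcs \<Gamma> then 1 else 0) * f v) = x * f u))"
    (is "?L \<longleftrightarrow> ?R")
proof -
  define m where "m = length vs"
  let ?a = "\<lambda>u v. (if (u, v) \<in> parcs \<Gamma> then 1 else 0 :: real)"
  have bij: "bij_betw ((!) vs) {0..<m} (set vs)"
    unfolding m_def atLeast0LessThan by (rule bij_betw_nth[OF vs]) auto
  have reindex: "(\<Sum>v\<in>set vs. ?a u v * f v) = (\<Sum>j\<in>{0..<m}. ?a u (vs ! j) * f (vs ! j))" for u f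
    using sum.reindex_bij_betw[OF bij, of "\<lambda>v. ?a u v * f v"] by simp
  have row: "(adjacency_mat vs \<Gamma> *\<^sub>v w) $ i = (\<Sum>j\<in>{0..<m}. ?a (vs ! i) (vs ! j) * w $ j)"
    if "w \<in> carrier_vec m" "i < m" for w i
    using that by (auto simp: adjacency_mat_def scalar_prod_def m_def intro!: sum.cong)
  have dims: "dim_row (adjacency_mat vs \<Gamma>) = m" "dim_col (adjacency_mat vs \<Gamma>) = m"
    by (auto simp: adjacency_mat_def m_def)
  have in_set: "u \<in> set vs \<longleftrightarrow> (\<exists>i<m. u = vs ! i)" for u
    by (auto simp: in_set_conv_nth m_def)
  show ?thesis
  proof
    assume ?L
    then obtain w where w: "w \<in> carrier_vec m" "w \<noteq> 0\<^sub>v m"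
      and eq: "adjacency_mat vs \<Gamma> *\<^sub>v w = x \<cdot>\<^sub>v w"
      by (auto simp: eigenvalue_def eigenvector_def dims)
    define f where "f = (\<lambda>u. w $ inv_into {0..<m} ((!) vs) u)"
    have f: "f (vs ! i) = w $ i" if "i < m" for i
      using that bij_betw_inv_into_left[OF bij, of i] by (simp add: f_def)
    obtain i where i: "i < m" "w $ i \<noteq> 0"
      using w by (metis carrier_vecD eq_vecI index_zero_vec)
    have "(\<Sum>v\<in>set vs. ?a (vs ! i) v * f v) = x * f (vs ! i)" if "i < m" for i
    proof -
      have "(\<Sum>v\<in>set vs. ?a (vs ! i) v * f v) = (\<Sum>j\<in>{0..<m}. ?a (vs ! i) (vs ! j) * w $ j)"
        unfolding reindex by (rule sum.cong) (auto simp: f)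
      also have "\<dots> = (x \<cdot>\<^sub>v w) $ i"
        using row[OF w(1) that] eq by simp
      also have "\<dots> = x * f (vs ! i)"
        using that w(1) by (simp add: f)
      finally show ?thesis .
    qed
    then have "\<forall>u\<in>set vs. (\<Sum>v\<in>set vs. ?a u v * f v) = x * f u"
      by (metis in_set)
    moreover have "\<exists>u\<in>set vs. f u \<noteq> 0"
      using i f[OF i(1)] in_set by metis
    ultimately show ?R by blast
  next
    assume ?R
    then obtain f u where f: "u \<in> set vs" "f u \<noteq> 0"
      "\<forall>u\<in>set vs. (\<Sum>v\<in>set vs. ?a u v * f v) = x * f u" by blast
    define w where "w = vec m (\<lambda>i. f (vs ! i))"
    have w: "w \<in> carrier_vec m" by (simp add: w_def)
    obtain i where "i < m" "u = vs ! i" using f(1) in_set by blast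
    then have "w $ i \<noteq> 0" using f(2) by (simp add: w_def)
    then have "w \<noteq> 0\<^sub>v m" using \<open>i < m\<close> by auto
    moreover have "adjacency_mat vs \<Gamma> *\<^sub>v w = x \<cdot>\<^sub>v w"
    proof (rule eq_vecI)
      fix i assume "i < dim_vec (x \<cdot>\<^sub>v w)"
      then have i: "i < m" by (simp add: w_def)
      have "(adjacency_mat vs \<Gamma> *\<^sub>v w) $ i = (\<Sum>v\<in>set vs. ?a (vs ! i) v * f v)"
        unfolding row[OF w i] reindex by (rule sum.cong) (auto simp: w_def)
      also have "\<dots> = x * f (vs ! i)" using f(3) i in_set by blast
      finally show "(adjacency_mat vs \<Gamma> *\<^sub>v w) $ i = (x \<cdot>\<^sub>v w) $ i"
        using i by (simp add: w_def)
    qed (simp add: dims w_def)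
    ultimately show ?L
      using w by (auto simp: eigenvalue_def eigenvector_def dims)
  qed
qed

lemma graph_eigenvalues_eq:
  assumes "distinct vs" "set vs = pverts \<Gamma>"
  shows "graph_eigenvalues \<Gamma> = {x. eigenvalue (adjacency_mat vs \<Gamma>) x}"
proof -
  have "eigenvalue (adjacency_mat ws \<Gamma>) x \<longleftrightarrow> eigenvalue (adjacency_mat vs \<Gamma>) x"
    if "distinct ws" "set ws = pverts \<Gamma>" for ws x
    unfolding eigenvalue_adjacency_mat_iff[OF that(1)] eigenvalue_adjacency_mat_iff[OF assms(1)]
      that(2) assms(2) by (rule refl)
  then show ?thesis
    using assms unfolding graph_eigenvalues_def by blast
qed

end

theory Submission
  imports Defs "Jordan_Normal_Form.Spectral_Radius" "HOL-Combinatorics.Multiset_Permutations"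
begin

text \<open>Write $H = C(n,k;r)$. If a function $w$ on the points satisfies
  $\sum_{h \in H} w(h(i)) = \mu\, w(i)$ for all $i$, then $f(u) = w(u(n))$ satisfies
  $\sum_{h \in H} f(hu) = \mu f(u)$ on $G$, and since $H = H^{-1}$ this says that it is an
  eigenfunction of the Cayley graph (\<open>cayley_graph_eigenvalueI\<close>). So an eigenvector of the small
  matrix that counts the $h \in H$ with $h(i) = j$ is enough.

  Conjugation by a permutation of $\{r+1,\dots,n\}$ preserves $H$. Because $r < k < n$ gives
  $r + 1 \le n - 1$, the transposition $\tau = (n-1\; n)$ is such a permutation, and the function
  $w = 1_{n} - 1_{n-1}$ spans the functions on points that change sign under $\tau$.
  By symmetry it is an eigenvector of the counting matrix, with eigenvalue $a - b$,
  where $a$ and $b$ are the numbers of $h \in H$ with $h(n) = n$ and $h(n) = n-1$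
  (\<open>sum_indicator_difference_eigen\<close>).

  A cycle has exactly one list representation with a prescribed first moved point. Starting at $1$,
  which every $h \in H$ moves, gives $a = \binom{n-1-r}{k-r}(k-1)!$; starting at $n$, followed by
  $n-1$, gives $b = \binom{n-r-2}{k-r-2}(k-2)!$ (\<open>card_cycles_fixing_last\<close>,
  \<open>card_cycles_sending_last_to_previous\<close>). Then $a - b = \mu_2$ by the absorption identities for
  binomial coefficients (\<open>card_difference_closed_form\<close>).

  The constant function shows that the degree $|H|$ is an eigenvalue too. Some cycle in $H$ moves
  $n$, so $\mu_2 \le a < |H|$; hence at least one eigenvalue lies above $\mu_2$, and
  $\lambda_2 \ge \mu_2$.\<close>

section \<open>Eigenvalues of graphs and Cayley graphs\<close>

lemma finite_graph_eigenvalues: "finite (graph_eigenvalues \<Gamma>)"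
proof (cases "\<exists>vs. distinct vs \<and> set vs = pverts \<Gamma>")
  case True
  then obtain vs where vs: "distinct vs" "set vs = pverts \<Gamma>" by blast
  have "adjacency_mat vs \<Gamma> \<in> carrier_mat (length vs) (length vs)"
    by (simp add: adjacency_mat_def)
  from card_finite_spectrum(1)[OF this] show ?thesis
    by (simp add: graph_eigenvalues_eq[OF vs] spectrum_def)
next
  case False
  then have "graph_eigenvalues \<Gamma> = {}"
    unfolding graph_eigenvalues_def by blast
  then show ?thesis by simp
qed

lemma second_largest_eigenvalue_ge:
  assumes "x \<in> graph_eigenvalues \<Gamma>" "y \<in> graph_eigenvalues \<Gamma>" "x < y"
  shows "x \<le> nth_largest_eigenvalue \<Gamma> 2"
proof -
  define L where "L = rev (sorted_list_of_set (graph_eigenvalues \<Gamma>))"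
  have set_L: "set L = graph_eigenvalues \<Gamma>"
    by (simp add: L_def finite_graph_eigenvalues)
  have sorted: "sorted (rev L)"
    by (simp add: L_def)
  obtain i where i: "i < length L" "L ! i = x"
    using assms(1) set_L by (metis in_set_conv_nth)
  obtain j where j: "j < length L" "L ! j = y"
    using assms(2) set_L by (metis in_set_conv_nth)
  \<comment> \<open>\<open>L\<close> is decreasing, so the larger value \<open>y\<close> precedes \<open>x\<close>, which is hence not at index \<open>0\<close>.\<close>
  have "j < i"
    using sorted_rev_nth_mono[OF sorted, of i j] i j assms(3) by (meson leD leI)
  then have "L ! i \<le> L ! 1"
    using i by (intro sorted_rev_nth_mono[OF sorted]) auto
  then show ?thesis
    using i by (simp add: nth_largest_eigenvalue_def L_def)
qed

text \<open>The neighbours of $u$ are the $v$ with $uv^{-1} = h \in H$, that is $v = h^{-1}u$. Closure of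
  $H$ under inverses turns the sum over neighbours into a sum over the products $hu$.\<close>

lemma (in group) cayley_graph_eigenvalueI:
  assumes fin: "finite (carrier G)" and H: "H \<subseteq> carrier G"
    and inv_H: "\<And>h. h \<in> H \<Longrightarrow> inv h \<in> H"
    and nonzero: "\<exists>u\<in>carrier G. f u \<noteq> 0"
    and eq: "\<And>u. u \<in> carrier G \<Longrightarrow> (\<Sum>h\<in>H. f (h \<otimes> u)) = x * f u"
  shows "x \<in> graph_eigenvalues (cayley_graph G H)"
proof -
  obtain vs where vs: "distinct vs" "set vs = carrier G"
    using finite_distinct_list[OF fin] by blast
  have "(\<Sum>v\<in>carrier G. (if (u, v) \<in> parcs (cayley_graph G H) then 1 else 0) * f v) = x * f u"
    if u: "u \<in> carrier G" for u
  proof -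
    have "(\<Sum>v\<in>carrier G. (if (u, v) \<in> parcs (cayley_graph G H) then 1 else 0) * f v)
        = (\<Sum>v\<in>{v \<in> carrier G. u \<otimes> inv v \<in> H}. f v)"
      using u by (auto simp: cayley_graph_def sum.inter_filter[OF fin] intro!: sum.cong)
    also have "\<dots> = (\<Sum>h\<in>H. f (h \<otimes> u))"
    proof (rule sum.reindex_bij_witness[where i = "\<lambda>h. h \<otimes> u" and j = "\<lambda>v. v \<otimes> inv u"])
      fix v assume "v \<in> {v \<in> carrier G. u \<otimes> inv v \<in> H}"
      then have v: "v \<in> carrier G" "u \<otimes> inv v \<in> H" by auto
      show "v \<otimes> inv u \<otimes> u = v"
        using u v by (simp add: m_assoc)
      show "v \<otimes> inv u \<in> H"
        using inv_H[OF v(2)] u v(1) by (simp add: inv_mult_group)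
      show "f (v \<otimes> inv u \<otimes> u) = f v"
        using u v by (simp add: m_assoc)
    next
      fix h assume h: "h \<in> H"
      then have h': "h \<in> carrier G" using H by blast
      show "h \<otimes> u \<otimes> inv u = h"
        using u h' by (simp add: m_assoc)
      have "u \<otimes> inv (h \<otimes> u) = inv h"
        using u h' by (simp add: inv_mult_group m_assoc[symmetric])
      then show "h \<otimes> u \<in> {v \<in> carrier G. u \<otimes> inv v \<in> H}"
        using u h' inv_H[OF h] by simp
    qed
    finally show ?thesis
      using eq[OF u] by simp
  qed
  then have "eigenvalue (adjacency_mat vs (cayley_graph G H)) x"
    unfolding eigenvalue_adjacency_mat_iff[OF vs(1)] vs(2) using nonzero by blast
  moreover have "pverts (cayley_graph G H) = carrier G"
    by (simp add: cayley_graph_def)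
  ultimately show ?thesis
    using vs by (auto simp: graph_eigenvalues_def)
qed

section \<open>Sets of maps invariant under conjugation by a transposition\<close>

text \<open>Let $S(i)$ be the left-hand side. Replacing every $h$ by $\tau h \tau$ and using
  $w \circ \tau = -w$ gives $S = -S \circ \tau$. Thus $S$ vanishes at every fixed point of $\tau$,
  and $S(q) = -S(p)$, so that $S$ is the multiple $S(p)\, w$ of $w$.\<close>

lemma sum_indicator_difference_eigen:
  fixes H :: "('a \<Rightarrow> 'a) set" and p q :: 'a
  defines "\<tau> \<equiv> transpose p q"
    and "w \<equiv> \<lambda>i. of_bool (i = p) - of_bool (i = q) :: real"
  assumes fin: "finite H" and pq: "p \<noteq> q"
    and conj: "\<And>h. h \<in> H \<Longrightarrow> \<tau> \<circ> h \<circ> \<tau> \<in> H"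
  shows "(\<Sum>h\<in>H. w (h i)) = (real (card {h \<in> H. h p = p}) - real (card {h \<in> H. h p = q})) * w i"
proof -
  define S where "S = (\<lambda>i. \<Sum>h\<in>H. w (h i))"
  have w_\<tau>: "w (\<tau> j) = - w j" for j
    using pq by (auto simp: w_def \<tau>_def transpose_def)
  have anti: "S i = - S (\<tau> i)" for i
  proof -
    have "S i = (\<Sum>h\<in>H. w ((\<tau> \<circ> h \<circ> \<tau>) i))"
      unfolding S_def
      by (rule sum.reindex_bij_witness[where i = "\<lambda>h. \<tau> \<circ> h \<circ> \<tau>" and j = "\<lambda>h. \<tau> \<circ> h \<circ> \<tau>"])
        (auto simp: conj \<tau>_def fun_eq_iff intro: conj[unfolded \<tau>_def])
    also have "\<dots> = - S (\<tau> i)"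
      by (simp add: S_def w_\<tau> sum_negf)
    finally show ?thesis .
  qed
  have Sp: "S p = real (card {h \<in> H. h p = p}) - real (card {h \<in> H. h p = q})"
    using fin by (simp add: S_def w_def sum_subtractf of_bool_def sum.If_cases Int_def)
  consider "i = p" | "i = q" | "i \<noteq> p" "i \<noteq> q" by blast
  then have "S i = S p * w i"
  proof cases
    case 1 then show ?thesis using pq by (simp add: w_def)
  next
    case 2 then show ?thesis using pq anti[of q] by (simp add: w_def \<tau>_def)
  next
    case 3 then show ?thesis using anti[of i] by (simp add: w_def \<tau>_def)
  qed
  then show ?thesis
    by (simp add: Sp) (simp add: S_def)
qed

section \<open>Cycles\<close>

lemma evenperm_cycle_of_list:
  "distinct cs \<Longrightarrow> cs \<noteq> [] \<Longrightarrow> evenperm (cycle_of_list cs) \<longleftrightarrow> odd (length cs)"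
proof (induction cs rule: cycle_of_list.induct)
  case (1 i j cs)
  then show ?case
    by (simp add: evenperm_comp[OF permutation_swap_id permutation_of_cycle] evenperm_swap
        del: o_apply)
qed (simp_all add: evenperm_id)

text \<open>The defining equation of \<^const>\<open>cycle_of_list\<close> splits off a transposition at the front of the
  list; splitting one off at the end is what the reversal of a list needs.\<close>

lemma cycle_of_list_snoc:
  "cycle_of_list (xs @ [j, i]) = cycle_of_list (xs @ [j]) \<circ> transpose j i"
proof (induction xs)
  case (Cons x xs)
  then show ?case
    by (cases xs) (auto simp: o_assoc[symmetric])
qed simp

lemma cycle_of_list_rev: "cycle_of_list (rev cs) = inv' (cycle_of_list cs)"
proof (induction cs rule: cycle_of_list.induct)
  case (1 i j cs)
  have "bij (cycle_of_list (j # cs))"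
    by (rule permutation_bijective[OF permutation_of_cycle])
  then have "inv' (transpose i j \<circ> cycle_of_list (j # cs))
      = inv' (cycle_of_list (j # cs)) \<circ> transpose i j"
    by (subst o_inv_distrib) auto
  then show ?case
    using 1 by (simp add: cycle_of_list_snoc transpose_commute del: o_apply)
qed simp_all

lemma funpow_cycle_of_list_nth:
  assumes "distinct (x # xs)" "i \<le> length xs"
  shows "(cycle_of_list (x # xs) ^^ i) x = (x # xs) ! i"
proof -
  have "(cycle_of_list (x # xs) ^^ i) x = hd (map (cycle_of_list (x # xs) ^^ i) (x # xs))"
    by simp
  also have "\<dots> = hd (rotate i (x # xs))"
    by (simp only: cyclic_rotation[OF assms(1)])
  also have "\<dots> = (x # xs) ! i"
    using assms(2) by (subst hd_rotate_conv_nth) auto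
  finally show ?thesis .
qed

text \<open>Once its first entry is prescribed, the list can be read off from the cycle by iterating it on
  that entry.\<close>

lemma cycle_of_list_inject:
  assumes "distinct (x # xs)" "distinct (x # ys)" "length xs = length ys"
    and "cycle_of_list (x # xs) = cycle_of_list (x # ys)"
  shows "xs = ys"
proof -
  have "(x # xs) ! i = (x # ys) ! i" if "i < length (x # xs)" for i
    using that assms funpow_cycle_of_list_nth[of x xs i] funpow_cycle_of_list_nth[of x ys i] by simp
  then have "x # xs = x # ys"
    using assms(3) by (intro nth_equalityI) auto
  then show ?thesis by simp
qed

lemma cycle_of_list_start_at:
  assumes "distinct cs" "x \<in> set cs"
  obtains xs where "cycle_of_list cs = cycle_of_list (x # xs)" "distinct (x # xs)"
    "set (x # xs) = set cs" "length (x # xs) = length cs"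
proof -
  obtain ys zs where cs: "cs = ys @ x # zs"
    using assms(2) by (meson split_list)
  have "rotate (length ys) cs = x # zs @ ys"
    by (simp add: cs rotate_append)
  then show ?thesis
    using that[of "zs @ ys"] cycle_of_list_rotate_independent[OF assms(1), of "length ys"] assms(1) cs
    by auto
qed

lemma cycle_of_list_hd:
  assumes "distinct (x # y # zs)"
  shows "cycle_of_list (x # y # zs) x = y"
  using funpow_cycle_of_list_nth[OF assms, of 1] by simp

lemma cycle_of_list_eq_self_iff:
  assumes "distinct cs" "2 \<le> length cs"
  shows "cycle_of_list cs x = x \<longleftrightarrow> x \<notin> set cs"
proof
  assume fix_x: "cycle_of_list cs x = x"
  show "x \<notin> set cs"
  proof
    assume "x \<in> set cs"
    with assms(1) obtain xs where xs: "cycle_of_list cs = cycle_of_list (x # xs)" "distinct (x # xs)"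
      "length (x # xs) = length cs"
      by (rule cycle_of_list_start_at)
    then obtain y ys where "xs = y # ys"
      using assms(2) by (cases xs) auto
    then show False
      using cycle_of_list_hd[of x y ys] xs fix_x by auto
  qed
qed (rule id_outside_supp)

section \<open>Counting cycles\<close>

text \<open>A set $S$ between $A$ and $B$ is determined by $S - A$, which can be any subset of $B - A$ of the
  right size.\<close>

lemma card_sets_between:
  assumes "finite B" "A \<subseteq> B" "card A \<le> m"
  shows "card {S. A \<subseteq> S \<and> S \<subseteq> B \<and> card S = m} = card (B - A) choose (m - card A)"
proof -
  have finA: "finite A" using assms finite_subset by blast
  have "bij_betw (\<lambda>S. S - A) {S. A \<subseteq> S \<and> S \<subseteq> B \<and> card S = m} {T. T \<subseteq> B - A \<and> card T = m - card A}"
  proof (rule bij_betwI[where g = "\<lambda>T. T \<union> A"])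
    show "(\<lambda>T. T \<union> A) \<in> {T. T \<subseteq> B - A \<and> card T = m - card A} \<rightarrow> {S. A \<subseteq> S \<and> S \<subseteq> B \<and> card S = m}"
    proof
      fix T assume T: "T \<in> {T. T \<subseteq> B - A \<and> card T = m - card A}"
      then have "card (T \<union> A) = card T + card A"
        using finA assms(1) by (intro card_Un_disjoint) (auto intro: finite_subset)
      then show "T \<union> A \<in> {S. A \<subseteq> S \<and> S \<subseteq> B \<and> card S = m}"
        using T assms by auto
    qed
  qed (auto simp: card_Diff_subset finA)
  then show ?thesis
    using n_subsets[of "B - A" "m - card A"] assms(1) by (simp add: bij_betw_same_card)
qed

definition lists_between :: "nat \<Rightarrow> 'a set \<Rightarrow> 'a set \<Rightarrow> 'a list set" where
  "lists_between m A B = {xs. distinct xs \<and> length xs = m \<and> A \<subseteq> set xs \<and> set xs \<subseteq> B}"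

lemma card_lists_between:
  assumes "finite B" "A \<subseteq> B" "card A \<le> m"
  shows "card (lists_between m A B) = (card (B - A) choose (m - card A)) * fact m"
proof -
  let ?F = "{S. A \<subseteq> S \<and> S \<subseteq> B \<and> card S = m}"
  have finF: "finite ?F"
    using assms(1) by simp
  have finS: "finite S" if "S \<in> ?F" for S
    using that assms(1) finite_subset by blast
  have "lists_between m A B = (\<Union>S\<in>?F. permutations_of_set S)"
    by (auto simp: lists_between_def permutations_of_set_def distinct_card)
  also have "card \<dots> = (\<Sum>S\<in>?F. card (permutations_of_set S))"
    using finF by (intro card_UN_disjoint ballI impI finite_permutations_of_set)
      (auto dest: permutations_of_setD)
  also have "\<dots> = (\<Sum>S\<in>?F. fact m)"
    using finS by (intro sum.cong) auto
  finally show ?thesis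
    by (simp add: card_sets_between[OF assms])
qed

lemma lists_between_eq_empty:
  assumes "m < card A"
  shows "lists_between m A B = {}"
proof -
  have "card A \<le> length xs" if "A \<subseteq> set xs" for xs
    using card_mono[OF _ that] card_length[of xs] by simp
  then show ?thesis
    using assms by (force simp: lists_between_def)
qed

text \<open>Cycles do not correspond one-to-one to these lists: for $k \ge 2$, each cycle
  comes from the $k$ rotations of one list.
  The counts below therefore fix the starting point.\<close>

lemma cycles_moving_eq:
  "cycles_moving n k r = cycle_of_list ` lists_between k {1..r} {1..n}"
  by (auto simp: cycles_moving_def lists_between_def)

text \<open>As $r \ge 1$, each of these cycles moves $1$ and is written uniquely as a list starting with
  $1$. The remaining $k - 1$ entries contain $2,\dots,r$ and avoid $n$.\<close>

lemma card_cycles_fixing_last: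
  assumes "1 \<le> r" "r < k" "k < n"
  shows "card {h \<in> cycles_moving n k r. h n = n} = ((n - 1 - r) choose (k - r)) * fact (k - 1)"
proof -
  have "{h \<in> cycles_moving n k r. h n = n}
      = (\<lambda>xs. cycle_of_list (1 # xs)) ` lists_between (k - 1) {2..r} {2..n - 1}" (is "?L = ?R")
  proof
    show "?L \<subseteq> ?R"
    proof
      fix h assume "h \<in> ?L"
      then obtain cs where cs: "h = cycle_of_list cs" "distinct cs" "length cs = k"
        "{1..r} \<subseteq> set cs" "set cs \<subseteq> {1..n}" and hn: "h n = n"
        by (auto simp: cycles_moving_def)
      have "n \<notin> set cs"
        using hn cs assms cycle_of_list_eq_self_iff[of cs n] by simp
      have "1 \<in> set cs" using cs assms by auto
      with cs(2) obtain xs where xs: "cycle_of_list cs = cycle_of_list (1 # xs)" "distinct (1 # xs)"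
        "set (1 # xs) = set cs" "length (1 # xs) = length cs"
        by (rule cycle_of_list_start_at)
      have set_xs: "set xs = set cs - {1}"
        using xs by auto
      have "set xs \<subseteq> {2..n - 1}"
      proof
        fix y assume "y \<in> set xs"
        then have "y \<in> set cs" "y \<noteq> 1" using set_xs by auto
        moreover then have "y \<noteq> n" "1 \<le> y" "y \<le> n" using cs(5) \<open>n \<notin> set cs\<close> by auto
        ultimately show "y \<in> {2..n - 1}" by auto
      qed
      moreover have "{2..r} \<subseteq> set xs"
        using cs(4) set_xs by auto
      ultimately have "xs \<in> lists_between (k - 1) {2..r} {2..n - 1}"
        using xs(2,4) cs(3) by (auto simp: lists_between_def)
      then show "h \<in> ?R"
        using xs(1) cs(1) by blast
    qed
    show "?R \<subseteq> ?L"
    proof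
      fix h assume "h \<in> ?R"
      then obtain xs where h: "h = cycle_of_list (1 # xs)" and xs: "distinct xs" "length xs = k - 1"
        "{2..r} \<subseteq> set xs" "set xs \<subseteq> {2..n - 1}"
        by (auto simp: lists_between_def)
      have "{1..r} \<subseteq> insert 1 {2..r}"
        by auto
      also have "\<dots> \<subseteq> set (1 # xs)"
        using xs(3) by auto
      finally have sub: "{1..r} \<subseteq> set (1 # xs)" .
      have "set xs \<subseteq> {1..n}"
        using xs(4) by (rule order_trans) auto
      then have "1 # xs \<in> lists_between k {1..r} {1..n}"
        using xs assms sub by (auto simp: lists_between_def)
      then have "h \<in> cycles_moving n k r"
        unfolding cycles_moving_eq h by (rule imageI)
      moreover have "n \<notin> set (1 # xs)"
        using xs assms by auto
      then have "h n = n"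
        unfolding h by (rule id_outside_supp)
      ultimately show "h \<in> ?L" by simp
    qed
  qed
  moreover have "inj_on (\<lambda>xs. cycle_of_list (1 # xs)) (lists_between (k - 1) {2..r} {2..n - 1})"
  proof (rule inj_onI)
    fix xs ys
    assume "xs \<in> lists_between (k - 1) {2..r} {2..n - 1}"
      "ys \<in> lists_between (k - 1) {2..r} {2..n - 1}"
      "cycle_of_list (1 # xs) = cycle_of_list (1 # ys)"
    then show "xs = ys"
      by (intro cycle_of_list_inject[of 1]) (auto simp: lists_between_def)
  qed
  moreover have "card (lists_between (k - 1) {2..r} {2..n - 1}) =
      ((n - 1 - r) choose (k - r)) * fact (k - 1)"
  proof -
    have "{2..n - 1} - {2..r} = {r + 1..n - 1}"
      using assms by auto
    then show ?thesis
      using assms by (subst card_lists_between) auto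
  qed
  ultimately show ?thesis
    by (simp add: card_image)
qed

text \<open>Each of these cycles is written uniquely as a list starting with $n, n - 1$, and the remaining
  $k - 2$ entries have to contain $1,\dots,r$. The case $k = r + 1$ is separate because there are
  too few entries, while the truncated difference $k - r - 2 = 0$ would give a binomial
  coefficient $1$.\<close>

lemma card_cycles_sending_last_to_previous:
  assumes "1 \<le> r" "r < k" "k < n"
  shows "card {h \<in> cycles_moving n k r. h n = n - 1} =
    (if k = r + 1 then 0 else ((n - r - 2) choose (k - r - 2)) * fact (k - 2))"
proof -
  have "{h \<in> cycles_moving n k r. h n = n - 1}
      = (\<lambda>xs. cycle_of_list (n # (n - 1) # xs)) ` lists_between (k - 2) {1..r} {1..n - 2}"
    (is "?L = ?R")
  proof
    show "?L \<subseteq> ?R"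
    proof
      fix h assume "h \<in> ?L"
      then obtain cs where cs: "h = cycle_of_list cs" "distinct cs" "length cs = k"
        "{1..r} \<subseteq> set cs" "set cs \<subseteq> {1..n}" and hn: "h n = n - 1"
        by (auto simp: cycles_moving_def)
      have "n \<in> set cs"
        using hn cs(1) assms id_outside_supp[of n cs] by fastforce
      with cs(2) obtain ys where ys: "cycle_of_list cs = cycle_of_list (n # ys)" "distinct (n # ys)"
        "set (n # ys) = set cs" "length (n # ys) = length cs"
        by (rule cycle_of_list_start_at)
      then obtain y xs where "ys = y # xs"
        using assms cs(3) by (cases ys) auto
      then have ys_eq: "ys = (n - 1) # xs"
        using cycle_of_list_hd[of n y xs] hn cs(1) ys(1,2) by simp
      have set_xs: "set xs = set cs - {n, n - 1}"
        using ys(2,3) ys_eq by auto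
      have "set xs \<subseteq> {1..n - 2}"
      proof
        fix y assume "y \<in> set xs"
        then have "y \<in> set cs" "y \<noteq> n" "y \<noteq> n - 1" using set_xs by auto
        moreover then have "1 \<le> y" "y \<le> n" using cs(5) by auto
        ultimately show "y \<in> {1..n - 2}" by auto
      qed
      moreover have "{1..r} \<subseteq> set xs"
        using cs(4) set_xs assms by auto
      ultimately have "xs \<in> lists_between (k - 2) {1..r} {1..n - 2}"
        using ys(2,4) cs(3) ys_eq by (auto simp: lists_between_def)
      then show "h \<in> ?R"
        using ys(1) ys_eq cs(1) by blast
    qed
    show "?R \<subseteq> ?L"
    proof
      fix h assume "h \<in> ?R"
      then obtain xs where h: "h = cycle_of_list (n # (n - 1) # xs)"
        and xs: "distinct xs" "length xs = k - 2" "{1..r} \<subseteq> set xs" "set xs \<subseteq> {1..n - 2}"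
        by (auto simp: lists_between_def)
      have dist: "distinct (n # (n - 1) # xs)"
        using xs assms by force
      moreover have "set xs \<subseteq> {1..n}"
        using xs(4) by (rule order_trans) auto
      ultimately have "n # (n - 1) # xs \<in> lists_between k {1..r} {1..n}"
        using xs assms by (auto simp: lists_between_def)
      then have "h \<in> cycles_moving n k r"
        unfolding cycles_moving_eq h by (rule imageI)
      then show "h \<in> ?L"
        using cycle_of_list_hd[OF dist] h by (simp del: cycle_of_list.simps)
    qed
  qed
  moreover have "inj_on (\<lambda>xs. cycle_of_list (n # (n - 1) # xs))
      (lists_between (k - 2) {1..r} {1..n - 2})"
  proof (rule inj_onI)
    fix xs ys
    assume A: "xs \<in> lists_between (k - 2) {1..r} {1..n - 2}"
      "ys \<in> lists_between (k - 2) {1..r} {1..n - 2}"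
      "cycle_of_list (n # (n - 1) # xs) = cycle_of_list (n # (n - 1) # ys)"
    have "distinct (n # (n - 1) # zs)" if "zs \<in> lists_between (k - 2) {1..r} {1..n - 2}" for zs
    proof -
      have "set zs \<subseteq> {1..n - 2}" "distinct zs"
        using that by (auto simp: lists_between_def)
      then show ?thesis
        using assms by force
    qed
    then have "distinct (n # (n - 1) # xs)" "distinct (n # (n - 1) # ys)"
      using A by blast+
    then have "(n - 1) # xs = (n - 1) # ys"
      by (rule cycle_of_list_inject) (use A in \<open>auto simp: lists_between_def\<close>)
    then show "xs = ys" by simp
  qed
  ultimately have card_eq:
    "card {h \<in> cycles_moving n k r. h n = n - 1} = card (lists_between (k - 2) {1..r} {1..n - 2})"
    by (simp add: card_image)
  show ?thesis
  proof (cases "k = r + 1")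
    case True
    then show ?thesis
      unfolding card_eq using assms by (subst lists_between_eq_empty) auto
  next
    case False
    have "{1..n - 2} - {1..r} = {r + 1..n - 2}"
      by auto
    then show ?thesis
      unfolding card_eq using assms False
      by (subst card_lists_between) (auto simp: diff_commute)
  qed
qed

section \<open>Closure properties of the set of cycles\<close>

lemma finite_cycles_moving: "finite (cycles_moving n k r)"
proof -
  have "lists_between k {1..r} {1..n} \<subseteq> {xs. set xs \<subseteq> {1..n} \<and> length xs = k}"
    by (auto simp: lists_between_def)
  then have "finite (lists_between k {1..r} {1..n})"
    by (rule finite_subset) (simp add: finite_lists_length_eq)
  then show ?thesis
    by (simp add: cycles_moving_eq)
qed

lemma cycles_moving_permutes:
  assumes "h \<in> cycles_moving n k r"
  shows "h permutes {1..n}"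
  using assms cycle_permutes permutes_subset by (fastforce simp: cycles_moving_def)

lemma evenperm_cycles_moving:
  assumes "h \<in> cycles_moving n k r" "odd k"
  shows "evenperm h"
proof -
  obtain cs where "h = cycle_of_list cs" "distinct cs" "length cs = k"
    using assms(1) by (auto simp: cycles_moving_def)
  moreover then have "cs \<noteq> []" using assms(2) by auto
  ultimately show ?thesis using assms(2) by (simp add: evenperm_cycle_of_list)
qed

lemma inv_cycles_moving:
  assumes "h \<in> cycles_moving n k r"
  shows "inv' h \<in> cycles_moving n k r"
proof -
  obtain cs where cs: "cs \<in> lists_between k {1..r} {1..n}" "h = cycle_of_list cs"
    using assms by (auto simp: cycles_moving_eq)
  then have "rev cs \<in> lists_between k {1..r} {1..n}"
    by (simp add: lists_between_def)
  then show ?thesis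
    using cs(2) by (auto simp: cycles_moving_eq cycle_of_list_rev[symmetric])
qed

text \<open>Conjugation relabels the entries of a cycle; a permutation that fixes $1,\dots,r$ pointwise
  leaves them among the moved points.\<close>

lemma conj_cycles_moving:
  assumes "h \<in> cycles_moving n k r" "p permutes {r + 1..n}"
  shows "p \<circ> h \<circ> inv' p \<in> cycles_moving n k r"
proof -
  obtain cs where cs: "distinct cs" "length cs = k" "{1..r} \<subseteq> set cs" "set cs \<subseteq> {1..n}"
    "h = cycle_of_list cs"
    using assms(1) by (auto simp: cycles_moving_def)
  have p: "p permutes {1..n}"
    using assms(2) by (rule permutes_subset) auto
  have "p ` {1..r} = {1..r}"
    using permutes_not_in[OF assms(2)] by force
  then have "{1..r} \<subseteq> set (map p cs)"
    using image_mono[OF cs(3), of p] by simp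
  moreover have "set (map p cs) \<subseteq> {1..n}"
    using image_mono[OF cs(4), of p] permutes_image[OF p] by simp
  moreover have "distinct (map p cs)"
    using cs(1) permutes_inj_on[OF p] by (simp add: distinct_map)
  moreover have conj: "p \<circ> h \<circ> inv' p = cycle_of_list (map p cs)"
    unfolding cs(5) by (rule conjugation_of_cycle[OF cs(1) permutes_bij[OF p]])
  ultimately have "map p cs \<in> lists_between k {1..r} {1..n}"
    using cs(2) by (simp add: lists_between_def)
  then show ?thesis
    unfolding conj cycles_moving_eq by (rule imageI)
qed

lemma exists_cycle_moving_last:
  assumes "r < k" "2 \<le> k" "k < n"
  obtains h where "h \<in> cycles_moving n k r" "h n \<noteq> n"
proof
  let ?cs = "[1..<k] @ [n]"
  have cs: "distinct ?cs" "length ?cs = k"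
    using assms by auto
  show "cycle_of_list ?cs \<in> cycles_moving n k r"
    unfolding cycles_moving_eq using cs assms by (intro imageI) (auto simp: lists_between_def)
  show "cycle_of_list ?cs n \<noteq> n"
    using cycle_of_list_eq_self_iff[OF cs(1), of n] cs(2) assms(2) by simp
qed

section \<open>The eigenvalue in closed form\<close>

text \<open>With $N = n - r$ and $K = k - r$, absorption expresses both binomial coefficients through
  $\binom{N}{K}$: $\binom{N-1}{K} = \binom{N}{K}\frac{N-K}{N}$ and
  $\binom{N-2}{K-2} = \binom{N}{K}\frac{K(K-1)}{N(N-1)}$. For $K = 1$ the right-hand side of the
  latter is $0$, in agreement with the count.\<close>

lemma card_difference_closed_form:
  fixes n k r :: nat
  assumes "1 \<le> r" "r < k" "k < n"
  shows "real (((n - 1 - r) choose (k - r)) * fact (k - 1))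
      - real (if k = r + 1 then 0 else ((n - r - 2) choose (k - r - 2)) * fact (k - 2))
    = fact (k - 2) * real ((n - r) choose (k - r)) * (1 / (real n - real r)) *
           ((real k - 1) * (real n - real k)
            - (real k - real r - 1) * (real k - real r) / (real n - real r - 1))"
proof -
  define N K where "N = n - r" and "K = k - r"
  have NK: "0 < K" "K < N" and n: "real n = real N + real r" and k: "real k = real K + real r"
    using assms by (auto simp: N_def K_def)
  define c where "c = real (N choose K)"
  have a: "real ((N - 1) choose K) = c * (real N - real K) / real N"
  proof -
    have "real ((N - K) * (N choose K)) = real (N * ((N - 1) choose K))"
      using binomial_absorb_comp[of N K] by simp
    then show ?thesis
      using NK by (simp add: c_def field_simps of_nat_diff)
  qed
  have b: "real (if K = 1 then 0 else (N - 2) choose (K - 2))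
      = c * real K * (real K - 1) / real N / (real N - 1)"
  proof (cases "K = 1")
    case False
    have "K * (N choose K) = N * ((N - 1) choose (K - 1))"
      using times_binomial_minus1_eq[of K N] NK by simp
    moreover have "(K - 1) * ((N - 1) choose (K - 1)) = (N - 1) * ((N - 2) choose (K - 2))"
      using times_binomial_minus1_eq[of "K - 1" "N - 1"] NK False
      by (simp add: numeral_2_eq_2)
    ultimately have "(K - 1) * (K * (N choose K)) = N * ((N - 1) * ((N - 2) choose (K - 2)))"
      by (metis mult.left_commute)
    then have "real ((K - 1) * (K * (N choose K))) = real (N * ((N - 1) * ((N - 2) choose (K - 2))))"
      by simp
    then have "(real K - 1) * real K * c = real N * (real N - 1) * real ((N - 2) choose (K - 2))"
      using NK by (simp add: c_def of_nat_diff mult.assoc)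
    moreover have "real N \<noteq> 0" "real N - 1 \<noteq> 0"
      using NK by auto
    ultimately show ?thesis
      using False by (simp add: field_simps)
  qed simp
  have fact: "fact (k - 1) = (real k - 1) * fact (k - 2)"
  proof -
    have "k - 1 = Suc (k - 2)" using assms by simp
    then show ?thesis using assms by (simp add: of_nat_diff)
  qed
  have "real (((n - 1 - r) choose (k - r)) * fact (k - 1))
      - real (if k = r + 1 then 0 else ((n - r - 2) choose (k - r - 2)) * fact (k - 2))
    = real ((N - 1) choose K) * (real k - 1) * fact (k - 2)
      - real (if K = 1 then 0 else (N - 2) choose (K - 2)) * fact (k - 2)"
    using assms fact by (auto simp: N_def K_def diff_commute)
  also have "\<dots> = fact (k - 2) * c * (1 / real N) *
      ((real k - 1) * (real N - real K) - (real K - 1) * real K / (real N - 1))"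
    unfolding a b by (simp add: divide_inverse algebra_simps)
  also have "\<dots> = fact (k - 2) * c * (1 / (real n - real r)) *
      ((real k - 1) * (real n - real k)
        - (real k - real r - 1) * (real k - real r) / (real n - real r - 1))"
    by (simp add: n k)
  finally show ?thesis
    unfolding c_def N_def K_def .
qed

section \<open>The two eigenvalues of the Cayley graph\<close>

theorem theorem1p3:
  fixes n k r :: nat
    and G :: "(nat \<Rightarrow> nat) monoid"
    and H :: "(nat \<Rightarrow> nat) set"
    and \<Gamma> :: "(nat \<Rightarrow> nat) pair_pre_digraph"
    and \<mu>\<^sub>2 :: real
  assumes "n > 4"
    and "1 \<le> r" and "r < k" and "k < n"
    and "G = (if even k then sym_group n else alt_group n)"
    and "H = cycles_moving n k r"
    and "\<Gamma> = cayley_graph G H"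
    and "\<mu>\<^sub>2 = fact (k - 2) * real ((n - r) choose (k - r)) * (1 / (real n - real r)) *
           ((real k - 1) * (real n - real k)
            - (real k - real r - 1) * (real k - real r) / (real n - real r - 1))"
  shows "\<mu>\<^sub>2 \<in> graph_eigenvalues \<Gamma> \<and> nth_largest_eigenvalue \<Gamma> 2 \<ge> \<mu>\<^sub>2"
proof -
  have grp: "group G"
    using assms(5) sym_group_is_group alt_group_is_group by simp
  have mult: "mult G = (\<circ>)"
    using assms(5) by (simp add: sym_group_mult alt_group_mult)
  have one: "id \<in> carrier G"
    using group.is_monoid[OF grp, THEN monoid.one_closed] assms(5)
    by (simp add: sym_group_one alt_group_one split: if_splits)
  have inv_eq: "inv\<^bsub>G\<^esub> h = inv' h" if "h \<in> carrier G" for h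
    using that assms(5) by (simp add: alt_group_inv_equality split: if_splits)
  have finG: "finite (carrier G)"
    by (rule finite_subset[OF _ finite_permutations[of "{1..n}"]])
      (auto simp: assms(5) sym_group_carrier alt_group_carrier split: if_splits)
  have HG: "H \<subseteq> carrier G"
    using cycles_moving_permutes evenperm_cycles_moving
    by (auto simp: assms(5,6) sym_group_carrier alt_group_carrier)
  have invH: "inv\<^bsub>G\<^esub> h \<in> H" if "h \<in> H" for h
    using that HG inv_eq inv_cycles_moving assms(6) by auto
  have finH: "finite H"
    by (simp add: assms(6) finite_cycles_moving)
  define w :: "nat \<Rightarrow> real" where "w = (\<lambda>i. of_bool (i = n) - of_bool (i = n - 1))"
  have \<mu>: "\<mu>\<^sub>2 = real (card {h \<in> H. h n = n}) - real (card {h \<in> H. h n = n - 1})"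
    unfolding assms(6,8) card_cycles_fixing_last[OF assms(2-4)]
      card_cycles_sending_last_to_previous[OF assms(2-4)]
      card_difference_closed_form[OF assms(2-4)] ..
  have conj: "transpose n (n - 1) \<circ> h \<circ> transpose n (n - 1) \<in> H" if "h \<in> H" for h
  proof -
    have "transpose n (n - 1) permutes {r + 1..n}"
      using assms(3,4) by (intro permutes_swap_id) auto
    from conj_cycles_moving[OF _ this] that show ?thesis
      by (simp add: assms(6))
  qed
  have "(\<Sum>h\<in>H. w (h i)) = \<mu>\<^sub>2 * w i" for i
    unfolding \<mu> w_def
    by (rule sum_indicator_difference_eigen) (use finH conj assms(4) in auto)
  \<comment> \<open>The eigenfunction is nonzero because it takes the value \<open>1\<close> at the identity, for both groups.\<close>
  then have eigen: "\<mu>\<^sub>2 \<in> graph_eigenvalues \<Gamma>"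
    unfolding assms(7)
    by (intro group.cayley_graph_eigenvalueI[OF grp finG HG invH, where f = "\<lambda>u. w (u n)"])
      (use one assms(4) in \<open>auto simp: mult w_def intro!: bexI[of _ id]\<close>)
  have degree: "real (card H) \<in> graph_eigenvalues \<Gamma>"
    unfolding assms(7)
    by (intro group.cayley_graph_eigenvalueI[OF grp finG HG invH, where f = "\<lambda>_. 1"])
      (use one in auto)
  have "card {h \<in> H. h n = n} < card H"
  proof -
    obtain h where "h \<in> H" "h n \<noteq> n"
      using exists_cycle_moving_last[of r k n] assms(2-4,6) by auto
    then show ?thesis
      by (intro psubset_card_mono finH) auto
  qed
  then have "\<mu>\<^sub>2 < real (card H)"
    by (simp add: \<mu>)
  then show ?thesis
    using eigen degree second_largest_eigenvalue_ge by blast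
qed

end
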